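(* Let $N\ge 2$, let $\mathcal H$ be an $N$-dimensional complex Hilbert space with fixed orthonormal basis $\{|\mu\rangle\}_{\mu=0}^{N-1}$, and let $\Lambda$ be the completely positive trace-preserving map $$\Lambda(\rho)=\sum_{\mu=0}^{N-1}\rho_{\mu\mu}|\mu\rangle\langle\mu|+\sum_{\mu<\nu}\Big[\rho_{\mu\nu}(1+\alpha_{\mu\nu})|\mu\rangle\langle\nu|+\mathrm{h.c.}\Big],$$ where $\alpha_{\mu\nu}\in\mathbb C$ and $|1+\alpha_{\mu\nu}|<1$ for all $\mu<\nu$. Then for every density operator $\rho$ on $\mathcal H$ the limit $\lim_{r\to\infty}\Lambda^r(\rho)$ (with $\Lambda^r$ the $r$-fold composition) is an incoherent state minimizing the relative entropy with respect to $\rho$ over all incoherent states: $$S\big(\rho\,\|\,\lim_{r\to\infty}\Lambda^r(\rho)\big)=\min_{\delta\in\mathbb I}S(\rho\|\delta).$$ Equivalently, this minimum equals the relative entropy of coherence: $\min_{\delta\in\mathbb I}S(\rho\|\delta)=C_{r.e.}(\rho)$.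
   Context: $\rho_{\mu\nu}=\langle\mu|\rho|\nu\rangle$, and h.c. denotes the Hermitian conjugate. $\mathbb I$ is the set of incoherent states, i.e. density operators diagonal in the basis $\{|\mu\rangle\}$; it coincides with the set of attractors (stationary states) of the network. $S(\rho\|\sigma)=\mathrm{Tr}(\rho\log\rho)-\mathrm{Tr}(\rho\log\sigma)$ is the quantum relative entropy (equal to $+\infty$ if the support of $\rho$ is not contained in the support of $\sigma$), $S(\rho)=-\mathrm{Tr}(\rho\log\rho)$ is the von Neumann entropy, $\Delta(\cdot)=\sum_\mu|\mu\rangle\langle\mu|\cdot|\mu\rangle\langle\mu|$ is the complete dephasing map, and $C_{r.e.}(\rho)=S(\Delta(\rho))-S(\rho)$ is the relative entropy of coherence. *)

theory Defs
  imports "HOL-Analysis.Analysis"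
begin

text \<open>
  Operators on an \<open>N\<close>-dimensional Hilbert space with a fixed orthonormal basis are represented by
  their matrices in that basis, of type \<open>'n cmat\<close>. The type \<open>'n\<close> labels the basis
  vectors, so \<open>N = CARD('n)\<close>; its linear order is the order of the labels. The entry
  \<open>A $ \<mu> $ \<nu>\<close> is the matrix element of \<open>A\<close> between the basis vectors \<open>\<mu>\<close> and \<open>\<nu>\<close>.
\<close>

type_synonym 'n cmat = "complex ^ 'n ^ 'n"

definition cinner_vec :: "complex ^ 'n \<Rightarrow> complex ^ 'n \<Rightarrow> complex" where
  "cinner_vec x y = (\<Sum>i\<in>UNIV. cnj (x $ i) * y $ i)"

definition cscale :: "complex \<Rightarrow> complex ^ 'n ^ 'm \<Rightarrow> complex ^ 'n ^ 'm" where
  "cscale c A = map_matrix ((*) c) A"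

definition adjoint_mat :: "complex ^ 'n ^ 'm \<Rightarrow> complex ^ 'm ^ 'n" where
  "adjoint_mat A = map_matrix cnj (transpose A)"

definition ketbra :: "'n::finite \<Rightarrow> 'n \<Rightarrow> 'n cmat" where
  "ketbra \<mu> \<nu> = (\<chi> i j. if i = \<mu> \<and> j = \<nu> then 1 else 0)"

definition diag_mat :: "('n::finite \<Rightarrow> real) \<Rightarrow> 'n cmat" where
  "diag_mat d = (\<chi> i j. if i = j then complex_of_real (d i) else 0)"

definition unitary_mat :: "('n::finite) cmat \<Rightarrow> bool" where
  "unitary_mat U \<longleftrightarrow> adjoint_mat U ** U = mat 1 \<and> U ** adjoint_mat U = mat 1"

definition psd :: "('n::finite) cmat \<Rightarrow> bool" where
  "psd A \<longleftrightarrow> (\<forall>v. cinner_vec v (A *v v) \<in> \<real>\<^sub>\<ge>\<^sub>0)"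

definition density_op :: "('n::finite) cmat \<Rightarrow> bool" where
  "density_op \<rho> \<longleftrightarrow> psd \<rho> \<and> trace \<rho> = 1"

definition incoherent :: "(('n::finite) cmat) set" where
  "incoherent = {\<delta>. density_op \<delta> \<and> (\<forall>\<mu> \<nu>. \<mu> \<noteq> \<nu> \<longrightarrow> \<delta> $ \<mu> $ \<nu> = 0)}"


text \<open>
  A \<open>k \<times> k\<close> block matrix with blocks \<open>A i j\<close> (\<open>i, j < k\<close>) is an operator on the tensor product of
  the \<open>k\<close>-dimensional ancilla space with the system. Applying \<open>\<Lambda>\<close> to each block is the action of
  the identity on the ancilla tensored with \<open>\<Lambda>\<close>. Entries of \<open>A\<close> outside \<open>i, j < k\<close> play no role.
\<close>

definition block_psd :: "nat \<Rightarrow> (nat \<Rightarrow> nat \<Rightarrow> ('n::finite) cmat) \<Rightarrow> bool" where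
  "block_psd k A \<longleftrightarrow>
     (\<forall>v. (\<Sum>i<k. \<Sum>j<k. cinner_vec (v i) (A i j *v v j)) \<in> \<real>\<^sub>\<ge>\<^sub>0)"

definition completely_positive :: "(('n::finite) cmat \<Rightarrow> 'n cmat) \<Rightarrow> bool" where
  "completely_positive \<Lambda> \<longleftrightarrow>
     (\<forall>k A. block_psd k A \<longrightarrow> block_psd k (\<lambda>i j. \<Lambda> (A i j)))"

definition trace_preserving :: "(('n::finite) cmat \<Rightarrow> 'n cmat) \<Rightarrow> bool" where
  "trace_preserving \<Lambda> \<longleftrightarrow> (\<forall>A. trace (\<Lambda> A) = trace A)"

definition cptp :: "(('n::finite) cmat \<Rightarrow> 'n cmat) \<Rightarrow> bool" where
  "cptp \<Lambda> \<longleftrightarrow>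
     Vector_Spaces.linear cscale cscale \<Lambda> \<and> completely_positive \<Lambda> \<and> trace_preserving \<Lambda>"


text \<open>
  Logarithm of a positive semidefinite matrix through its spectral decomposition. The value
  \<open>U ln(d) U*\<close> does not depend on the chosen decomposition \<open>U d U*\<close>. Since \<open>ln 0 = 0\<close> for the type
  \<^typ>\<open>real\<close>, the logarithm is taken on the support and is zero on the kernel; this gives the
  convention \<open>0 log 0 = 0\<close> in the entropies.
\<close>

definition log_mat :: "('n::finite) cmat \<Rightarrow> 'n cmat" where
  "log_mat A = (THE L. \<exists>U d. unitary_mat U \<and> A = U ** diag_mat d ** adjoint_mat U \<and>
                             L = U ** diag_mat (\<lambda>i. ln (d i)) ** adjoint_mat U)"

definition vn_entropy :: "('n::finite) cmat \<Rightarrow> real" where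
  "vn_entropy \<rho> = - Re (trace (\<rho> ** log_mat \<rho>))"

text \<open>The support is the orthogonal complement of the kernel.\<close>

definition supp_mat :: "('n::finite) cmat \<Rightarrow> (complex ^ 'n) set" where
  "supp_mat A = {v. \<forall>w. A *v w = 0 \<longrightarrow> cinner_vec w v = 0}"

definition rel_entropy :: "('n::finite) cmat \<Rightarrow> 'n cmat \<Rightarrow> ereal" where
  "rel_entropy \<rho> \<sigma> =
     (if supp_mat \<rho> \<subseteq> supp_mat \<sigma>
      then ereal (Re (trace (\<rho> ** log_mat \<rho>)) - Re (trace (\<rho> ** log_mat \<sigma>)))
      else \<infinity>)"

definition dephase :: "('n::finite) cmat \<Rightarrow> 'n cmat" where
  "dephase \<rho> = (\<Sum>\<mu>\<in>UNIV. ketbra \<mu> \<mu> ** \<rho> ** ketbra \<mu> \<mu>)"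

definition rel_ent_coherence :: "('n::finite) cmat \<Rightarrow> real" where
  "rel_ent_coherence \<rho> = vn_entropy (dephase \<rho>) - vn_entropy \<rho>"

end

theory Submission
  imports Defs
begin

text \<open>
  Each application of \<open>\<Lambda>\<close> fixes the diagonal of a density operator and multiplies the entry at
  \<open>\<mu> < \<nu>\<close> by \<open>1 + \<alpha>\<^sub>\<mu>\<^sub>\<nu>\<close>, of modulus below 1, so the iterates converge to the diagonal part \<open>\<Delta>(\<rho>)\<close>.
  For a diagonal \<open>\<delta>\<close> whose support contains that of \<open>\<rho>\<close>, the relative entropy is
  \<open>Tr(\<rho> log \<rho>) - (\<Sum>\<^sub>\<mu> \<rho>\<^sub>\<mu>\<^sub>\<mu> log \<delta>\<^sub>\<mu>\<^sub>\<mu>)\<close>, which Gibbs' inequality minimizes at \<open>\<delta> = \<Delta>(\<rho>)\<close>. The term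
  \<open>Tr(\<rho> log \<rho>)\<close> is a common constant, so the spectral decomposition of \<open>\<rho>\<close> is never needed.
\<close>

section \<open>Diagonal matrices and their logarithm\<close>

lemma trace_mult_diag_mat: "trace (A ** diag_mat d) = (\<Sum>i\<in>UNIV. A $ i $ i * complex_of_real (d i))"
  by (simp add: trace_def matrix_matrix_mult_def diag_mat_def if_distrib [of "(*) _"] cong: if_cong)

lemma diag_mat_mult_nth: "(diag_mat d ** A) $ i $ j = complex_of_real (d i) * A $ i $ j"
  by (simp add: matrix_matrix_mult_def diag_mat_def if_distrib [of "\<lambda>x. x * _"] cong: if_cong)

lemma mult_diag_mat_nth: "(A ** diag_mat d) $ i $ j = A $ i $ j * complex_of_real (d j)"
  by (simp add: matrix_matrix_mult_def diag_mat_def if_distrib [of "(*) _"] cong: if_cong)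

lemma diag_mat_mult_vec_nth: "(diag_mat d *v w) $ i = complex_of_real (d i) * w $ i"
  by (simp add: matrix_vector_mult_def diag_mat_def if_distrib [of "\<lambda>x. x * _"] cong: if_cong)

text \<open>The definite description in \<open>log_mat\<close> demands existence and uniqueness. The
  identity matrix is a diagonalizing unitary; and a matrix intertwining two diagonal matrices also
  intertwines their logarithms, so every other decomposition gives the same result.\<close>

lemma log_mat_diag_mat: "log_mat (diag_mat d :: ('n::finite) cmat) = diag_mat (\<lambda>i. ln (d i))"
  unfolding log_mat_def
proof (rule the_equality)
  have "unitary_mat (mat 1 :: 'n cmat)" and "adjoint_mat (mat 1 :: 'n cmat) = mat 1"
    by (auto simp: unitary_mat_def adjoint_mat_def mat_def transpose_def map_matrix_def vec_eq_iff
        matrix_matrix_mult_def if_distrib [of "(*) _"] if_distrib [of cnj] cong: if_cong)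
  then show "\<exists>U e. unitary_mat U \<and> (diag_mat d :: 'n cmat) = U ** diag_mat e ** adjoint_mat U \<and>
      diag_mat (\<lambda>i. ln (d i)) = U ** diag_mat (\<lambda>i. ln (e i)) ** adjoint_mat U"
    by (intro exI [of _ "mat 1"] exI [of _ d]) simp
next
  fix L :: "'n cmat"
  assume "\<exists>U e. unitary_mat U \<and> diag_mat d = U ** diag_mat e ** adjoint_mat U \<and>
      L = U ** diag_mat (\<lambda>i. ln (e i)) ** adjoint_mat U"
  then obtain U e where U: "unitary_mat U" and d: "diag_mat d = U ** diag_mat e ** adjoint_mat U"
    and L: "L = U ** diag_mat (\<lambda>i. ln (e i)) ** adjoint_mat U" by blast
  have inv: "adjoint_mat U ** U = mat 1" "U ** adjoint_mat U = mat 1"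
    using U by (auto simp: unitary_mat_def)
  have "diag_mat d ** U = U ** diag_mat e"
    by (simp add: d inv flip: matrix_mul_assoc)
  \<comment> \<open>\<open>U\<close> intertwines the two diagonal matrices, hence connects only equal eigenvalues.\<close>
  then have "complex_of_real (d i) * U $ i $ j = U $ i $ j * complex_of_real (e j)" for i j
    by (metis diag_mat_mult_nth mult_diag_mat_nth)
  then have "d i = e j" if "U $ i $ j \<noteq> 0" for i j
    using that by (metis mult.commute mult_left_cancel of_real_eq_iff)
  then have "diag_mat (\<lambda>i. ln (d i)) ** U = U ** diag_mat (\<lambda>i. ln (e i))"
    unfolding vec_eq_iff diag_mat_mult_nth mult_diag_mat_nth
    by (metis mult.commute mult_zero_left)
  then have "L = diag_mat (\<lambda>i. ln (d i)) ** U ** adjoint_mat U"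
    by (simp add: L)
  then show "L = diag_mat (\<lambda>i. ln (d i))"
    by (simp add: inv flip: matrix_mul_assoc)
qed

section \<open>Entries, kernel and range of positive semidefinite matrices\<close>

lemma cinner_vec_axis_axis: "cinner_vec (axis i 1) (A *v axis j 1) = A $ i $ j"
  by (simp add: cinner_vec_def axis_def matrix_vector_mult_def if_distrib [of "(*) _"]
      if_distrib [of "\<lambda>x. x * _"] if_distrib [of cnj] cong: if_cong)

lemma cinner_vec_lincomb_axis:
  fixes A :: "('n::finite) cmat"
  defines "v \<equiv> \<lambda>i j s t. axis i s + axis j t :: complex ^ 'n"
  shows "cinner_vec (v i j s t) (A *v v i j s t) =
    cnj s * s * A $ i $ i + cnj s * t * A $ i $ j + cnj t * s * A $ j $ i + cnj t * t * A $ j $ j"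
proof -
  have "(A *v v i j s t) $ k = A $ k $ i * s + A $ k $ j * t" for k
    by (simp add: v_def matrix_vector_mult_def axis_def distrib_left sum.distrib
        if_distrib [of "(*) _"] cong: if_cong)
  moreover have "cinner_vec (v i j s t) w = cnj s * w $ i + cnj t * w $ j" for w
    by (simp add: v_def cinner_vec_def axis_def distrib_right sum.distrib
        if_distrib [of "\<lambda>x. x * _"] if_distrib [of cnj] cong: if_cong)
  ultimately show ?thesis by (simp add: algebra_simps)
qed

lemma psd_diag: "psd A \<Longrightarrow> A $ i $ i \<in> \<real>\<^sub>\<ge>\<^sub>0"
  by (metis psd_def cinner_vec_axis_axis)

lemma nonneg_Reals_complexD: "z \<in> \<real>\<^sub>\<ge>\<^sub>0 \<Longrightarrow> Im z = 0 \<and> 0 \<le> Re z"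
  by (simp add: complex_nonneg_Reals_iff)

text \<open>The quadratic form on a vector spanned by two basis vectors is real and nonnegative. Its
  diagonal terms are real, so the cross terms must add up to a real number.\<close>

lemma psd_offdiag:
  assumes "psd A"
  shows "Im (cnj s * t * A $ i $ j + cnj t * s * A $ j $ i) = 0"
    and "0 \<le> (cmod s)\<^sup>2 * Re (A $ i $ i) + Re (cnj s * t * A $ i $ j + cnj t * s * A $ j $ i)
      + (cmod t)\<^sup>2 * Re (A $ j $ j)"
proof -
  let ?x = "cnj s * t * A $ i $ j + cnj t * s * A $ j $ i"
  have sq: "cnj z * z = complex_of_real ((cmod z)\<^sup>2)" for z
    by (metis complex_norm_square mult.commute)
  have "complex_of_real ((cmod s)\<^sup>2) * A $ i $ i + ?x + complex_of_real ((cmod t)\<^sup>2) * A $ j $ j \<in> \<real>\<^sub>\<ge>\<^sub>0"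
    using assms [unfolded psd_def, THEN spec, of "axis i s + axis j t"]
    by (simp only: cinner_vec_lincomb_axis sq add.assoc)
  from nonneg_Reals_complexD [OF this]
    nonneg_Reals_complexD [OF psd_diag [OF assms, of i]] nonneg_Reals_complexD [OF psd_diag [OF assms, of j]]
  show "Im ?x = 0" and "0 \<le> (cmod s)\<^sup>2 * Re (A $ i $ i) + Re ?x + (cmod t)\<^sup>2 * Re (A $ j $ j)"
    by (simp_all del: of_real_power)
qed

lemma psd_hermitian:
  assumes "psd A"
  shows "A $ j $ i = cnj (A $ i $ j)"
  \<comment> \<open>Polarization: coefficients 1, 1 make the imaginary parts opposite, and
    coefficients 1, \<i> make the real parts equal.\<close>
  using psd_offdiag(1) [OF assms, of 1 1 i j] psd_offdiag(1) [OF assms, of 1 \<i> i j]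
  by (simp add: complex_eq_iff)

text \<open>With a vanishing diagonal entry the quadratic term in the \<open>i\<close> coefficient
  disappears, so a nonzero off-diagonal entry could push the form below zero.\<close>

lemma psd_zero_diag_imp_zero_column:
  assumes "psd A" and "A $ i $ i = 0"
  shows "A $ j $ i = 0"
proof (rule ccontr)
  define a where "a = A $ j $ i"
  assume "A $ j $ i \<noteq> 0"
  then have a: "(cmod a)\<^sup>2 > 0" by (simp add: a_def)
  \<comment> \<open>On the vector with coefficient 1 at \<open>j\<close> and
    \<open>- s * cnj a\<close> at \<open>i\<close> the form equals \<open>A $ j $ j\<close> minus
    twice \<open>s * |a|^2\<close>; this \<open>s\<close> turns it into
    \<open>- A $ j $ j - 2\<close>, which is negative.\<close>
  define s where "s = (Re (A $ j $ j) + 1) / (cmod a)\<^sup>2"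
  have "A $ i $ j = cnj a"
    using psd_hermitian [OF assms(1)] a_def by metis
  then have "0 \<le> Re (A $ j $ j) - 2 * s * (cmod a)\<^sup>2"
    using psd_offdiag(2) [OF assms(1), where s = 1 and t = "- of_real s * cnj a" and i = j and j = i] assms(2)
    unfolding cmod_power2 by (simp add: a_def [symmetric] power2_eq_square algebra_simps)
  then have "0 \<le> - Re (A $ j $ j) - 2"
    using a by (simp add: s_def)
  moreover have "0 \<le> Re (A $ j $ j)"
    using nonneg_Reals_complexD [OF psd_diag [OF assms(1)]] by blast
  ultimately show False by simp
qed

lemma cinner_vec_mult_adjoint:
  assumes "psd A"
  shows "cinner_vec w (A *v u) = cinner_vec (A *v w) u"
proof -
  have herm: "cnj (A $ i $ j) = A $ j $ i" for i j
    using psd_hermitian [OF assms] by metis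
  have "cinner_vec w (A *v u) = (\<Sum>i\<in>UNIV. \<Sum>j\<in>UNIV. cnj (w $ i) * A $ i $ j * u $ j)"
    by (simp add: cinner_vec_def matrix_vector_mult_def sum_distrib_left mult.assoc)
  also have "\<dots> = (\<Sum>j\<in>UNIV. \<Sum>i\<in>UNIV. cnj (w $ i) * A $ i $ j * u $ j)"
    by (rule sum.swap)
  also have "\<dots> = cinner_vec (A *v w) u"
    by (simp add: cinner_vec_def matrix_vector_mult_def sum_distrib_left herm mult_ac)
  finally show ?thesis .
qed

text \<open>By self-adjointness the range is orthogonal to the kernel. This supplies concrete
  vectors of the support.\<close>

lemma psd_range_subset_supp: "psd A \<Longrightarrow> A *v u \<in> supp_mat A"
  by (auto simp: supp_mat_def cinner_vec_mult_adjoint) (simp add: cinner_vec_def)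

lemma psd_diag_mat:
  assumes "\<And>i. 0 \<le> d i"
  shows "psd (diag_mat d)"
proof -
  have "cnj z * (complex_of_real (d i) * z) = complex_of_real (d i * (cmod z)\<^sup>2)" for z i
    unfolding of_real_mult complex_norm_square by (simp add: mult_ac)
  then have "cinner_vec v (diag_mat d *v v) = complex_of_real (\<Sum>i\<in>UNIV. d i * (cmod (v $ i))\<^sup>2)" for v
    by (simp add: cinner_vec_def diag_mat_mult_vec_nth del: of_real_mult of_real_power)
  moreover have "0 \<le> (\<Sum>i\<in>UNIV. d i * (cmod (v $ i))\<^sup>2)" for v :: "complex ^ 'a"
    using assms by (intro sum_nonneg) auto
  ultimately show ?thesis unfolding psd_def by (metis nonneg_Reals_of_real_iff)
qed

section \<open>Dephasing and incoherent states\<close>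

lemma dephase_nth: "dephase A $ i $ j = (if i = j then A $ i $ i else 0)"
proof -
  have "(ketbra \<mu> \<mu> ** A ** ketbra \<mu> \<mu>) $ i $ j = (if \<mu> = i then if i = j then A $ i $ i else 0 else 0)" for \<mu>
    by (auto simp: ketbra_def matrix_matrix_mult_def if_distrib [of "(*) _"] if_distrib [of "\<lambda>x. x * _"]
       cong: if_cong)
  then show ?thesis by (simp add: dephase_def sum.delta)
qed

lemma psd_diag_eq: "psd A \<Longrightarrow> A $ i $ i = complex_of_real (Re (A $ i $ i))"
  using nonneg_Reals_complexD [OF psd_diag] by (auto simp: complex_eq_iff)

lemma dephase_eq_diag_mat: "psd A \<Longrightarrow> dephase A = diag_mat (\<lambda>i. Re (A $ i $ i))"
  by (simp add: vec_eq_iff dephase_nth diag_mat_def psd_diag_eq [symmetric])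

lemma incoherent_eq_diag_mat: "\<delta> \<in> incoherent \<Longrightarrow> \<delta> = diag_mat (\<lambda>i. Re (\<delta> $ i $ i))"
  by (auto simp: vec_eq_iff diag_mat_def incoherent_def density_op_def psd_diag_eq [symmetric])

lemma dephase_in_incoherent:
  assumes "density_op \<rho>"
  shows "dephase \<rho> \<in> incoherent"
proof -
  have "psd \<rho>" using assms by (simp add: density_op_def)
  then have "psd (dephase \<rho>)"
    using nonneg_Reals_complexD [OF psd_diag] by (auto simp: dephase_eq_diag_mat intro!: psd_diag_mat)
  then show ?thesis
    using assms by (simp add: incoherent_def density_op_def dephase_nth trace_def)
qed

lemma density_op_sum_diag:
  assumes "density_op \<rho>"
  shows "(\<Sum>i\<in>UNIV. Re (\<rho> $ i $ i)) = 1"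
  using assms by (simp add: density_op_def trace_def flip: Re_sum)

section \<open>Relative entropy to a diagonal state\<close>

lemma supp_mat_subset_diag_mat_iff:
  assumes "psd \<rho>"
  shows "supp_mat \<rho> \<subseteq> supp_mat (diag_mat q) \<longleftrightarrow> (\<forall>i. q i = 0 \<longrightarrow> \<rho> $ i $ i = 0)"
proof
  assume sub: "supp_mat \<rho> \<subseteq> supp_mat (diag_mat q)"
  show "\<forall>i. q i = 0 \<longrightarrow> \<rho> $ i $ i = 0"
  proof (intro allI impI)
    fix i assume "q i = 0"
    then have "diag_mat q *v axis i 1 = 0"
      by (simp add: vec_eq_iff diag_mat_mult_vec_nth axis_def)
    \<comment> \<open>Column \<open>i\<close> of \<rho> lies in its support, hence is orthogonal to
      the basis vector \<open>i\<close> of the kernel.\<close>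
    moreover have "\<rho> *v axis i 1 \<in> supp_mat (diag_mat q)"
      using sub psd_range_subset_supp [OF assms] by blast
    ultimately have "cinner_vec (axis i 1) (\<rho> *v axis i 1) = 0"
      by (simp add: supp_mat_def)
    then show "\<rho> $ i $ i = 0" by (simp add: cinner_vec_axis_axis)
  qed
next
  assume zero: "\<forall>i. q i = 0 \<longrightarrow> \<rho> $ i $ i = 0"
  \<comment> \<open>Orthogonal complements reverse inclusion, so it suffices to compare
    kernels.\<close>
  have "\<rho> *v w = 0" if "diag_mat q *v w = 0" for w
  proof -
    have "q i = 0 \<or> w $ i = 0" for i
      using that diag_mat_mult_vec_nth [of q w i] by simp
    then have "\<rho> $ j $ i * w $ i = 0" for i j
      using psd_zero_diag_imp_zero_column [OF assms] zero by auto
    then show ?thesis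
      by (simp add: vec_eq_iff matrix_vector_mult_def sum.neutral)
  qed
  then show "supp_mat \<rho> \<subseteq> supp_mat (diag_mat q)"
    by (auto simp: supp_mat_def)
qed

lemma rel_entropy_diag_mat:
  assumes "psd \<rho>"
  shows "rel_entropy \<rho> (diag_mat q) =
    (if \<forall>i. q i = 0 \<longrightarrow> \<rho> $ i $ i = 0
     then ereal (Re (trace (\<rho> ** log_mat \<rho>)) - (\<Sum>i\<in>UNIV. Re (\<rho> $ i $ i) * ln (q i))) else \<infinity>)"
  by (simp add: rel_entropy_def supp_mat_subset_diag_mat_iff [OF assms] log_mat_diag_mat
      trace_mult_diag_mat)

section \<open>Gibbs' inequality and the minimum over incoherent states\<close>

text \<open>The tangent bound \<open>ln x \<le> x - 1\<close> at \<open>x = q i / p i\<close>,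
  weighted by \<open>p i\<close>, is summed over \<open>I\<close>.\<close>

lemma gibbs_inequality:
  fixes p q :: "'a \<Rightarrow> real"
  assumes "\<And>i. i \<in> I \<Longrightarrow> 0 \<le> p i" and "\<And>i. i \<in> I \<Longrightarrow> 0 \<le> q i"
    and "sum q I \<le> sum p I" and "\<And>i. i \<in> I \<Longrightarrow> q i = 0 \<Longrightarrow> p i = 0"
  shows "(\<Sum>i\<in>I. p i * ln (q i)) \<le> (\<Sum>i\<in>I. p i * ln (p i))"
proof -
  have "p i * ln (q i) - p i * ln (p i) \<le> q i - p i" if "i \<in> I" for i
  proof (cases "p i = 0")
    case True
    then show ?thesis using assms(2) that by simp
  next
    case False
    then have "p i > 0" "q i > 0" using assms(1,2,4) that by (force simp: less_le)+
    moreover from this have "ln (q i / p i) \<le> q i / p i - 1" by (intro ln_le_minus_one) simp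
    ultimately have "p i * ln (q i / p i) \<le> p i * (q i / p i - 1)" by simp
    with \<open>p i > 0\<close> \<open>q i > 0\<close> show ?thesis by (simp add: ln_div algebra_simps)
  qed
  then have "(\<Sum>i\<in>I. p i * ln (q i) - p i * ln (p i)) \<le> (\<Sum>i\<in>I. q i - p i)"
    by (rule sum_mono)
  then show ?thesis using assms(3) by (simp add: sum_subtractf)
qed

text \<open>The logarithm of the dephased state is diagonal, so its trace against \<rho> sees only
  the diagonal of \<rho> and equals minus the entropy of the dephased state.\<close>

lemma rel_entropy_dephase:
  assumes "density_op \<rho>"
  shows "rel_entropy \<rho> (dephase \<rho>) = ereal (rel_ent_coherence \<rho>)"
proof -
  have psd: "psd \<rho>" using assms by (simp add: density_op_def)
  \<comment> \<open>Diagonal entries are real, so the support condition holds and the finite branch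
    applies.\<close>
  have "\<forall>i. Re (\<rho> $ i $ i) = 0 \<longrightarrow> \<rho> $ i $ i = 0"
    using psd_diag_eq [OF psd] by (metis of_real_0)
  then show ?thesis
    using rel_entropy_diag_mat [OF psd, of "\<lambda>i. Re (\<rho> $ i $ i)"]
    by (simp add: rel_ent_coherence_def vn_entropy_def dephase_eq_diag_mat [OF psd]
        log_mat_diag_mat trace_mult_diag_mat) (simp add: diag_mat_def)
qed

lemma rel_entropy_dephase_le:
  assumes "density_op \<rho>" and "\<delta> \<in> incoherent"
  shows "rel_entropy \<rho> (dephase \<rho>) \<le> rel_entropy \<rho> \<delta>"
proof -
  have psd: "psd \<rho>" using assms by (simp add: density_op_def)
  have dens: "density_op \<delta>" using assms by (simp add: incoherent_def)
  let ?p = "\<lambda>i. Re (\<rho> $ i $ i)" and ?q = "\<lambda>i. Re (\<delta> $ i $ i)"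
  have "rel_entropy \<rho> (diag_mat ?p) \<le> rel_entropy \<rho> (diag_mat ?q)"
  proof (cases "\<forall>i. ?q i = 0 \<longrightarrow> \<rho> $ i $ i = 0")
    case True
    have "(\<Sum>i\<in>UNIV. ?p i * ln (?q i)) \<le> (\<Sum>i\<in>UNIV. ?p i * ln (?p i))"
    proof (rule gibbs_inequality)
      show "0 \<le> ?p i" "0 \<le> ?q i" for i
        using nonneg_Reals_complexD [OF psd_diag] psd dens by (auto simp: density_op_def)
    qed (use True in \<open>simp_all add: density_op_sum_diag assms dens\<close>)
    moreover have "\<forall>i. ?p i = 0 \<longrightarrow> \<rho> $ i $ i = 0"
      using psd_diag_eq [OF psd] by (metis of_real_0)
    ultimately show ?thesis using True by (simp add: rel_entropy_diag_mat [OF psd])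
  next
    \<comment> \<open>Here the support condition fails for \<delta>, and the right-hand side is
      infinite.\<close>
    case False
    then show ?thesis by (auto simp: rel_entropy_diag_mat [OF psd])
  qed
  then show ?thesis
    using dephase_eq_diag_mat [OF psd] incoherent_eq_diag_mat [OF assms(2)] by simp
qed

section \<open>The channel and its iterates\<close>

text \<open>Positivity is complete positivity for a one-dimensional ancilla, that is, block size
  1.\<close>

lemma cptp_density_op:
  assumes "cptp \<Lambda>" and "density_op \<sigma>"
  shows "density_op (\<Lambda> \<sigma>)"
proof -
  have "psd A \<longleftrightarrow> block_psd 1 (\<lambda>_ _. A)" for A :: "'a cmat"
  proof
    assume "block_psd 1 (\<lambda>_ _. A)"
    then have "\<forall>v. cinner_vec (v 0) (A *v v (0::nat)) \<in> \<real>\<^sub>\<ge>\<^sub>0"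
      by (simp add: block_psd_def)
    then show "psd A"
      unfolding psd_def by (intro allI) (drule spec [of _ "\<lambda>_. v" for v], simp)
  qed (simp add: psd_def block_psd_def)
  then show ?thesis
    using assms by (simp add: cptp_def density_op_def completely_positive_def trace_preserving_def)
qed

lemma adjoint_mat_nth: "adjoint_mat A $ i $ j = cnj (A $ j $ i)"
  by (simp add: adjoint_mat_def map_matrix_def transpose_def)

lemma cscale_ketbra_nth: "cscale z (ketbra \<mu> \<nu>) $ i $ j = (if (\<mu>, \<nu>) = (i, j) then z else 0)"
  by (auto simp: cscale_def ketbra_def map_matrix_def)

text \<open>Each off-diagonal position is hit exactly once: above the diagonal by a direct term,
  below it by the adjoint of the term for the swapped pair.\<close>

lemma dephasing_network_nth:
  fixes \<sigma> :: "('n::{finite,linorder}) cmat" and c :: "'n \<Rightarrow> 'n \<Rightarrow> complex"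
  shows "((\<Sum>\<mu>\<in>UNIV. cscale (\<sigma> $ \<mu> $ \<mu>) (ketbra \<mu> \<mu>))
      + (\<Sum>(\<mu>, \<nu>)\<in>{(\<mu>, \<nu>). \<mu> < \<nu>}.
           cscale (c \<mu> \<nu>) (ketbra \<mu> \<nu>) + adjoint_mat (cscale (c \<mu> \<nu>) (ketbra \<mu> \<nu>)))) $ i $ j
    = (if i = j then \<sigma> $ i $ i else if i < j then c i j else cnj (c j i))"
proof -
  let ?P = "{(\<mu>::'n, \<nu>). \<mu> < \<nu>}"
  have fin: "finite ?P" by simp
  have diag: "(\<Sum>\<mu>\<in>UNIV. cscale (\<sigma> $ \<mu> $ \<mu>) (ketbra \<mu> \<mu>) $ i $ j) = (if i = j then \<sigma> $ i $ i else 0)"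
  proof -
    have "cscale (\<sigma> $ \<mu> $ \<mu>) (ketbra \<mu> \<mu>) $ i $ j = (if i = \<mu> then if i = j then \<sigma> $ i $ i else 0 else 0)" for \<mu>
      by (simp add: cscale_ketbra_nth)
    then show ?thesis by simp
  qed
  have "cscale (c \<mu> \<nu>) (ketbra \<mu> \<nu>) $ i $ j = (if (\<mu>, \<nu>) = (i, j) then c i j else 0)"
    and "adjoint_mat (cscale (c \<mu> \<nu>) (ketbra \<mu> \<nu>)) $ i $ j
      = (if (\<mu>, \<nu>) = (j, i) then cnj (c j i) else 0)" for \<mu> \<nu>
    by (simp_all add: cscale_ketbra_nth adjoint_mat_nth)
  then have "(case p of (\<mu>, \<nu>) \<Rightarrow> cscale (c \<mu> \<nu>) (ketbra \<mu> \<nu>)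
        + adjoint_mat (cscale (c \<mu> \<nu>) (ketbra \<mu> \<nu>))) $ i $ j
      = (if p = (i, j) then c i j else 0) + (if p = (j, i) then cnj (c j i) else 0)" for p
    by (cases p) (simp only: prod.case vector_add_component)
  then have "(\<Sum>p\<in>?P. (case p of (\<mu>, \<nu>) \<Rightarrow> cscale (c \<mu> \<nu>) (ketbra \<mu> \<nu>)
        + adjoint_mat (cscale (c \<mu> \<nu>) (ketbra \<mu> \<nu>))) $ i $ j)
      = (if i < j then c i j else 0) + (if j < i then cnj (c j i) else 0)"
    using fin by (simp add: sum.distrib)
  with diag show ?thesis by auto
qed

theorem lemma2:
  fixes \<Lambda> :: "('n::{finite,linorder}) cmat \<Rightarrow> 'n cmat"
    and \<alpha> :: "'n \<Rightarrow> 'n \<Rightarrow> complex"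
    and \<rho> :: "'n cmat"
  assumes "CARD('n) \<ge> 2"
    and "cptp \<Lambda>"
    and "\<And>\<sigma>. density_op \<sigma> \<Longrightarrow>
           \<Lambda> \<sigma> = (\<Sum>\<mu>\<in>UNIV. cscale (\<sigma> $ \<mu> $ \<mu>) (ketbra \<mu> \<mu>))
               + (\<Sum>(\<mu>, \<nu>)\<in>{(\<mu>, \<nu>). \<mu> < \<nu>}.
                    cscale (\<sigma> $ \<mu> $ \<nu> * (1 + \<alpha> \<mu> \<nu>)) (ketbra \<mu> \<nu>)
                    + adjoint_mat (cscale (\<sigma> $ \<mu> $ \<nu> * (1 + \<alpha> \<mu> \<nu>)) (ketbra \<mu> \<nu>)))"
    and "\<And>\<mu> \<nu>. \<mu> < \<nu> \<Longrightarrow> cmod (1 + \<alpha> \<mu> \<nu>) < 1"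
    and "density_op \<rho>"
  shows "convergent (\<lambda>r. (\<Lambda> ^^ r) \<rho>)
       \<and> lim (\<lambda>r. (\<Lambda> ^^ r) \<rho>) \<in> incoherent
       \<and> (\<forall>\<delta>\<in>incoherent. rel_entropy \<rho> (lim (\<lambda>r. (\<Lambda> ^^ r) \<rho>)) \<le> rel_entropy \<rho> \<delta>)
       \<and> rel_entropy \<rho> (lim (\<lambda>r. (\<Lambda> ^^ r) \<rho>)) = (INF \<delta>\<in>incoherent. rel_entropy \<rho> \<delta>)
       \<and> (INF \<delta>\<in>incoherent. rel_entropy \<rho> \<delta>) = ereal (rel_ent_coherence \<rho>)"
proof -
  have nth: "\<Lambda> \<sigma> $ i $ j = (if i = j then \<sigma> $ i $ i else if i < j then \<sigma> $ i $ j * (1 + \<alpha> i j)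
      else cnj (\<sigma> $ j $ i * (1 + \<alpha> j i)))" if "density_op \<sigma>" for \<sigma> i j
    unfolding assms(3) [OF that] by (rule dephasing_network_nth)
  \<comment> \<open>The formula for \<Lambda> is assumed on density operators, so iterating it
    requires every iterate to be one.\<close>
  have dens: "density_op ((\<Lambda> ^^ r) \<rho>)" for r
    by (induction r) (simp_all add: assms(5) cptp_density_op [OF assms(2)])
  have diag: "(\<Lambda> ^^ r) \<rho> $ i $ i = \<rho> $ i $ i" for r i
    by (induction r) (simp_all add: nth dens)
  have upper: "(\<Lambda> ^^ r) \<rho> $ i $ j = \<rho> $ i $ j * (1 + \<alpha> i j) ^ r" if "i < j" for r i j
    using that by (induction r) (auto simp: nth dens)
  have upper_lim: "(\<lambda>r. (\<Lambda> ^^ r) \<rho> $ i $ j) \<longlonglongrightarrow> 0" if "i < j" for i j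
    unfolding upper [OF that] by (intro tendsto_mult_right_zero LIMSEQ_power_zero assms(4) that)
  have lower_lim: "(\<lambda>r. (\<Lambda> ^^ r) \<rho> $ j $ i) \<longlonglongrightarrow> 0" if "i < j" for i j
  proof -
    \<comment> \<open>Hermiticity of the iterates transfers the decay to the lower triangle.\<close>
    have "(\<Lambda> ^^ r) \<rho> $ j $ i = cnj ((\<Lambda> ^^ r) \<rho> $ i $ j)" for r
      using dens psd_hermitian unfolding density_op_def by blast
    then show ?thesis using tendsto_cnj [OF upper_lim [OF that]] by simp
  qed
  have "(\<lambda>r. (\<Lambda> ^^ r) \<rho>) \<longlonglongrightarrow> dephase \<rho>"
  proof (intro vec_tendstoI)
    fix i j
    show "(\<lambda>r. (\<Lambda> ^^ r) \<rho> $ i $ j) \<longlonglongrightarrow> dephase \<rho> $ i $ j"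
      by (cases i j rule: linorder_cases) (simp_all add: dephase_nth diag upper_lim lower_lim)
  qed
  then have "convergent (\<lambda>r. (\<Lambda> ^^ r) \<rho>)" and lim: "lim (\<lambda>r. (\<Lambda> ^^ r) \<rho>) = dephase \<rho>"
    by (auto simp: convergent_def limI)
  \<comment> \<open>The infimum is attained: the dephased state is itself incoherent and bounds all
    values from below.\<close>
  moreover have "(INF \<delta>\<in>incoherent. rel_entropy \<rho> \<delta>) = rel_entropy \<rho> (dephase \<rho>)"
    using assms(5)
    by (intro antisym INF_lower INF_greatest dephase_in_incoherent rel_entropy_dephase_le)
  ultimately show ?thesis
    using assms(5)
    by (simp add: dephase_in_incoherent rel_entropy_dephase_le flip: rel_entropy_dephase)
qed

end
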